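(* Let $\alpha,\beta,\gamma,\omega_1,\omega_2\in\mathbb{C}$ with $\mathrm{Re}(\alpha)>0$ and $\mathrm{Re}(\beta)>0$. Then the function $$u(t)=t^{\gamma-1}E_{\alpha,\beta,\gamma}^{1}(\omega_1t^{\alpha},\omega_2t^{\beta})$$ is a solution of the following fractional differential equation, an ODE involving two independent fractional orders of differentiation: $${}^{RL}_{\ \,0}D^{\alpha+\beta}_tu(t)-\omega_2\,{}^{RL}_{\ \,0}D^{\alpha}_tu(t)-\omega_1\,{}^{RL}_{\ \,0}D^{\beta}_tu(t)=\frac{t^{\gamma-\alpha-\beta-1}}{\Gamma(\gamma-\alpha-\beta)}.$$
   Context: For $\alpha,\beta,\gamma,\delta\in\mathbb{C}$ with $\mathrm{Re}(\alpha)>0$, $\mathrm{Re}(\beta)>0$ and $x,y\in\mathbb{C}$, the bivariate Mittag-Leffler function is $$E_{\alpha,\beta,\gamma}^{\delta}(x,y)=\sum_{k=0}^{\infty}\sum_{l=0}^{\infty}\frac{(\delta)_{k+l}}{\Gamma(\alpha k+\beta l+\gamma)}\cdot\frac{x^ky^l}{k!\,l!}$$ (the double series converges absolutely and locally uniformly), where $(a)_n=a(a+1)\cdots(a+n-1)$, $(a)_0=1$, is the Pochhammer symbol. Thus $$u(t)=\sum_{k=0}^{\infty}\sum_{l=0}^{\infty}\frac{(k+l)!}{\Gamma(\alpha k+\beta l+\gamma)}\cdot\frac{\omega_1^k\omega_2^l}{k!\,l!}\,t^{\alpha k+\beta l+\gamma-1}.$$ Riemann--Liouville operators with base point $c$: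 for $\mathrm{Re}(\nu)>0$, ${}^{RL}_{\ \,c}I_{t}^{\nu}f(t)=\frac{1}{\Gamma(\nu)}\int_c^t(t-\xi)^{\nu-1}f(\xi)\,\mathrm{d}\xi$; for $\mathrm{Re}(\nu)\geq0$, ${}^{RL}_{\ \,c}D_{t}^{\nu}f(t)=\frac{\mathrm{d}^m}{\mathrm{d}t^m}\,{}^{RL}_{\ \,c}I_{t}^{m-\nu}f(t)$ with $m=\lfloor\mathrm{Re}(\nu)\rfloor+1$.
   Formalization: The formal theorem adds the hypothesis Re(γ)>0: for Re(γ)≤0 the function u is in general not integrable at 0, so the operators are undefined, and for γ=0 with ω₁=ω₂=0 the equation fails unless α+β is a positive integer. *)

theory Defs
  imports "HOL-Analysis.Analysis"
begin

(* rGamma is the entire function 1/Gamma, equal to 0 at the poles 0, -1, -2, ... of Gamma;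
   gamma may be such that alpha k + beta l + gamma hits a pole. *)
definition bivariate_Mittag_Leffler ::
    "complex \<Rightarrow> complex \<Rightarrow> complex \<Rightarrow> complex \<Rightarrow> complex \<Rightarrow> complex \<Rightarrow> complex" where
  "bivariate_Mittag_Leffler \<alpha> \<beta> \<gamma> \<delta> x y =
     (\<Sum>k. \<Sum>l. pochhammer \<delta> (k + l) * rGamma (\<alpha> * of_nat k + \<beta> * of_nat l + \<gamma>)
                  * (x ^ k * y ^ l / (fact k * fact l)))"

(* Functions live on the real half-line (c, \<infinity>) and are complex-valued; complex powers of the
   positive real t - \<xi> are taken with the real logarithm, which is what powr gives there.
   The value at the base point is irrelevant, hence the open interval. *)
definition RL_integrand :: "complex \<Rightarrow> (real \<Rightarrow> complex) \<Rightarrow> real \<Rightarrow> real \<Rightarrow> complex" where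
  "RL_integrand \<nu> f t \<xi> = of_real (t - \<xi>) powr (\<nu> - 1) * f \<xi>"

definition RL_integral :: "real \<Rightarrow> complex \<Rightarrow> (real \<Rightarrow> complex) \<Rightarrow> real \<Rightarrow> complex" where
  "RL_integral c \<nu> f t =
     1 / Gamma \<nu> * set_lebesgue_integral lborel {c<..<t} (RL_integrand \<nu> f t)"

definition RL_order :: "complex \<Rightarrow> nat" where
  "RL_order \<nu> = nat \<lfloor>Re \<nu>\<rfloor> + 1"

definition iterated_vderiv :: "nat \<Rightarrow> (real \<Rightarrow> complex) \<Rightarrow> real \<Rightarrow> complex" where
  "iterated_vderiv n = (\<lambda>g t. vector_derivative g (at t)) ^^ n"

definition RL_derivative :: "real \<Rightarrow> complex \<Rightarrow> (real \<Rightarrow> complex) \<Rightarrow> real \<Rightarrow> complex" where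
  "RL_derivative c \<nu> f =
     iterated_vderiv (RL_order \<nu>) (RL_integral c (of_nat (RL_order \<nu>) - \<nu>) f)"

(* Lebesgue integrals and derivatives are total functions with arbitrary values where they do not
   exist. This predicate says that RL_derivative c \<nu> f genuinely exists on (c, \<infinity>): all the
   integrals converge and all the successive derivatives exist. *)
definition RL_differentiable :: "real \<Rightarrow> complex \<Rightarrow> (real \<Rightarrow> complex) \<Rightarrow> bool" where
  "RL_differentiable c \<nu> f \<longleftrightarrow>
     (\<forall>t>c. set_integrable lborel {c<..<t} (RL_integrand (of_nat (RL_order \<nu>) - \<nu>) f t)) \<and>
     (\<forall>j<RL_order \<nu>. \<forall>t>c.
        iterated_vderiv j (RL_integral c (of_nat (RL_order \<nu>) - \<nu>) f) differentiable (at t))"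

end

theory Submission
  imports Defs
begin

text \<open>
  Write \<open>p\<^sub>s(t) = t\<^bsup>s-1\<^esup> / \<Gamma>(s)\<close>. This family behaves under fractional calculus like a single
  semigroup: the Riemann--Liouville integral of order \<open>\<mu>\<close> sends \<open>p\<^sub>s\<close> to \<open>p\<close> with index \<open>s + \<mu>\<close>
  (Euler's Beta integral, \<open>RL_power_integral\<close>) when both have positive real part, and \<open>d/dt\<close> sends
  \<open>p\<^sub>s\<close> to \<open>p\<close> with index \<open>s - 1\<close>, for every complex \<open>s\<close>, because \<open>1/\<Gamma>\<close> is entire with \<open>1/\<Gamma>(s-1) =
  (s-1)/\<Gamma>(s)\<close>. The solution is the double series \<open>S\<^sub>\<gamma> = \<Sum>\<^sub>k\<^sub>,\<^sub>l (k+l choose k) \<omega>\<^sub>1\<^sup>k \<omega>\<^sub>2\<^sup>l p\<close>, the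
  index of \<open>p\<close> being \<open>\<alpha>k + \<beta>l + \<gamma>\<close>. Acting termwise, a fractional derivative of order \<open>\<nu>\<close> therefore
  just replaces \<open>\<gamma>\<close> by \<open>\<gamma> - \<nu>\<close> (\<open>RL_derivative_ml_series\<close>).

  After that, the differential equation is Pascal's rule. In the series with parameter \<open>\<gamma> - \<alpha> - \<beta>\<close>,
  the coefficient at \<open>(k,l) \<noteq> (0,0)\<close> is \<open>\<omega>\<^sub>1\<close> times the coefficient at \<open>(k-1,l)\<close> plus \<open>\<omega>\<^sub>2\<close> times
  the one at \<open>(k,l-1)\<close>, coefficients with a negative index being \<open>0\<close>. Moving from \<open>(k-1,l)\<close> to
  \<open>(k,l)\<close> raises the index by \<open>\<alpha>\<close>, so the first part sums to \<open>\<omega>\<^sub>1\<close> times the series with parameter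
  \<open>\<gamma> - \<beta>\<close>, and likewise the second to \<open>\<omega>\<^sub>2\<close> times the series with parameter \<open>\<gamma> - \<alpha>\<close>. What is left
  over is the term at \<open>(0,0)\<close>, the right-hand side (\<open>ml_series_three_term\<close>).

  The analytic work is to justify acting termwise. Integration needs a summable majorant of the
  integrands and differentiation a locally uniform one. Both follow from one bound
  (\<open>ml_term_bound\<close>), which rests on the decay of \<open>1/\<Gamma>(\<alpha>k + \<beta>l + \<gamma>)\<close> faster than any geometric
  sequence in \<open>k + l\<close> (\<open>rGamma_lattice_decay\<close>). Since \<open>\<alpha>\<close> and \<open>\<beta>\<close> have positive real part, these
  arguments eventually lie in a sector around the positive axis that is strictly narrower than the
  half-plane; there \<open>1/\<Gamma>\<close> is at most exponentially larger than its value at the real part.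
\<close>

section \<open>Decay of the reciprocal Gamma function in a sector\<close>

text \<open>
  Telescoping: the summand with index \<open>j + 1\<close> is at most \<open>1/(x+j) - 1/(x+j+1)\<close>. The negative last
  term is kept only to make the induction go through.
\<close>
lemma sum_inverse_squares_le:
  fixes x :: real
  assumes "x > 0"
  shows "(\<Sum>j\<le>n. 1 / (x + real j)^2) \<le> 1 / x^2 + 1 / x - 1 / (x + real n)"
proof (induction n)
  case (Suc n)
  have "1 / (x + real (Suc n))^2 \<le> 1 / ((x + real n) * (x + real (Suc n)))"
    using assms by (intro divide_left_mono) (auto simp: power2_eq_square intro!: mult_mono)
  also have "\<dots> = 1 / (x + real n) - 1 / (x + real (Suc n))"
    using assms by (simp add: field_simps)
  finally show ?case using Suc by simp
qed auto

text \<open>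
  In Gauss's limit for \<open>1/\<Gamma>\<close>, each factor satisfies \<open>\<bar>z + j\<bar> = (x + j) sqrt (1 + y\<^sup>2/(x+j)\<^sup>2) \<le> (x +
  j) exp (y\<^sup>2/(2(x+j)\<^sup>2))\<close> for \<open>z = x + \<i>y\<close>, and the exponents have a convergent sum. This replaces
  Stirling's formula: for \<open>\<bar>y\<bar> \<le> C x\<close> and \<open>x \<ge> 1\<close> the exponential factor is only \<open>exp (O(x))\<close>,
  negligible against \<open>\<Gamma>(x)\<close>.
\<close>
lemma norm_rGamma_le_Re:
  fixes z :: complex
  assumes "Re z > 0"
  shows "norm (rGamma z) \<le> rGamma (Re z) * exp ((Im z)^2 * (1 / (Re z)^2 + 1 / Re z) / 2)"
proof (rule LIMSEQ_le)
  let ?x = "Re z" and ?y = "Im z"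
  let ?E = "exp (?y^2 * (1 / ?x^2 + 1 / ?x) / 2)"
  show "(\<lambda>n. norm (rGamma_series z n)) \<longlonglongrightarrow> norm (rGamma z)"
    by (intro tendsto_intros)
  show "(\<lambda>n. rGamma_series ?x n * ?E) \<longlonglongrightarrow> rGamma ?x * ?E"
    by (intro tendsto_intros)
  have "norm (rGamma_series z n) \<le> rGamma_series ?x n * ?E" for n
  proof -
    have factor: "norm (z + of_nat j) \<le> (?x + real j) * exp (?y^2 * (1 / (?x + real j)^2) / 2)" for j
    proof -
      define r where "r = ?x + real j"
      have r: "r > 0" using assms by (simp add: r_def)
      have "(norm (z + of_nat j))^2 = r^2 + ?y^2"
        by (simp add: cmod_power2 r_def)
      also have "\<dots> = r^2 * (1 + ?y^2 * (1 / r^2))"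
        using r by (simp add: field_simps)
      also have "\<dots> \<le> r^2 * exp (?y^2 * (1 / r^2))"
        by (intro mult_left_mono exp_ge_add_one_self) auto
      also have "\<dots> = (r * exp (?y^2 * (1 / r^2) / 2))^2"
        by (simp add: power_mult_distrib flip: exp_double)
      finally show ?thesis
        unfolding r_def by (rule power2_le_imp_le) (use assms in auto)
    qed
    have "norm (pochhammer z (n+1)) = (\<Prod>j\<le>n. norm (z + of_nat j))"
      by (simp add: pochhammer_prod prod_norm lessThan_Suc_atMost atLeast0LessThan)
    also have "\<dots> \<le> (\<Prod>j\<le>n. (?x + real j) * exp (?y^2 * (1 / (?x + real j)^2) / 2))"
      by (intro prod_mono conjI factor norm_ge_zero)
    also have "\<dots> = pochhammer ?x (n+1) * exp (?y^2 / 2 * (\<Sum>j\<le>n. 1 / (?x + real j)^2))"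
      by (simp add: prod.distrib pochhammer_prod lessThan_Suc_atMost atLeast0LessThan exp_sum
            sum_distrib_left mult_ac)
    also have "\<dots> \<le> pochhammer ?x (n+1) * exp (?y^2 / 2 * (1 / ?x^2 + 1 / ?x))"
    proof (intro mult_left_mono)
      have "(\<Sum>j\<le>n. 1 / (?x + real j)^2) \<le> 1 / ?x^2 + 1 / ?x"
        using sum_inverse_squares_le[OF assms, of n] assms
        by (smt (verit) divide_nonneg_nonneg of_nat_0_le_iff)
      then show "exp (?y^2 / 2 * (\<Sum>j\<le>n. 1 / (?x + real j)^2)) \<le> exp (?y^2 / 2 * (1 / ?x^2 + 1 / ?x))"
        by (simp add: mult_left_mono)
    qed (use assms in \<open>simp add: pochhammer_nonneg\<close>)
    finally have P: "norm (pochhammer z (n+1)) \<le> pochhammer ?x (n+1) * ?E" by simp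
    have "norm (rGamma_series z n) = norm (pochhammer z (n+1)) / (fact n * exp (?x * ln (real n)))"
      by (simp add: rGamma_series_def norm_divide norm_mult norm_exp_eq_Re)
    also have "\<dots> \<le> (pochhammer ?x (n+1) * ?E) / (fact n * exp (?x * ln (real n)))"
      by (intro divide_right_mono P) auto
    finally show ?thesis by (simp add: rGamma_series_def)
  qed
  then show "\<exists>N. \<forall>n\<ge>N. norm (rGamma_series z n) \<le> rGamma_series ?x n * ?E" by blast
qed

text \<open>
  Restricting Euler's integral to \<open>[R, R+1]\<close> gives \<open>\<Gamma>(x) \<ge> R\<^bsup>x-1\<^esup> exp (-R-1)\<close>. The freedom to choose
  \<open>R\<close> makes this decay faster than any exponential.
\<close>
lemma rGamma_real_le_powr:
  fixes x R :: real
  assumes "x \<ge> 1" "R > 0"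
  shows "rGamma x \<le> exp (R + 1) * R powr (1 - x)"
proof -
  have "((\<lambda>t. R powr (x - 1) / exp (R + 1)) has_integral (R powr (x - 1) / exp (R + 1))) {R..R+1}"
    using has_integral_const_real[of "R powr (x - 1) / exp (R + 1)" R "R + 1"] by simp
  moreover have "((\<lambda>t. if t \<in> {R..R+1} then t powr (x - 1) / exp t else 0) has_integral
      integral {R..R+1} (\<lambda>t. t powr (x - 1) / exp t)) {R..R+1}"
  proof -
    have "(\<lambda>t. t powr (x - 1) / exp t) integrable_on {R..R+1}"
      using assms by (intro integrable_continuous_real continuous_intros) auto
    then show ?thesis
      by (subst has_integral_cong[where g = "\<lambda>t. t powr (x - 1) / exp t"]) (auto intro: integrable_integral)
  qed
  ultimately have "R powr (x - 1) / exp (R + 1) \<le> integral {R..R+1} (\<lambda>t. t powr (x - 1) / exp t)"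
    by (rule has_integral_le) (use assms in \<open>auto intro!: frac_le powr_mono2\<close>)
  also have "\<dots> \<le> Gamma x"
  proof -
    have G: "((\<lambda>t. t powr (x - 1) / exp t) has_integral Gamma x) {0..}"
      using assms by (intro Gamma_integral_real) auto
    have "(\<lambda>t. t powr (x - 1) / exp t) integrable_on {R..R+1}"
      using assms by (intro integrable_continuous_real continuous_intros) auto
    then show ?thesis
      using integral_subset_le[of "{R..R+1}" "{0..}" "\<lambda>t. t powr (x - 1) / exp t"] G assms
      by (auto simp: has_integral_iff)
  qed
  finally have "R powr (x - 1) / exp (R + 1) \<le> Gamma x" .
  then have "inverse (Gamma x) \<le> inverse (R powr (x - 1) / exp (R + 1))"
    using assms by (intro le_imp_inverse_le) auto
  also have "inverse (R powr (x - 1) / exp (R + 1)) = exp (R + 1) * R powr - (x - 1)"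
    by (simp only: powr_minus divide_inverse inverse_mult_distrib inverse_inverse_eq mult.commute)
  finally show ?thesis by (simp add: rGamma_inverse_Gamma)
qed

lemma rGamma_sector_decay:
  fixes C \<rho> :: real
  assumes "\<rho> > 0"
  obtains K where "K > 0"
    "\<And>z::complex. Re z \<ge> 1 \<Longrightarrow> \<bar>Im z\<bar> \<le> C * Re z \<Longrightarrow> norm (rGamma z) \<le> K * \<rho> powr Re z"
proof -
  \<comment> \<open>The numerator compensates the growth \<open>exp (C\<^sup>2 x / 2)\<close> allowed in the sector.\<close>
  define R where "R = exp (C^2 / 2) / \<rho>"
  have R: "R > 0" using assms by (simp add: R_def)
  show ?thesis
  proof (rule that[of "exp (R + 1) * R * exp (C^2 / 2)"])
    fix z :: complex assume z: "Re z \<ge> 1" "\<bar>Im z\<bar> \<le> C * Re z"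
    let ?x = "Re z"
    have "(Im z)^2 \<le> (C * ?x)^2"
      using z by (metis abs_ge_zero power2_abs power_mono)
    then have "(Im z)^2 * (1 / ?x^2 + 1 / ?x) / 2 \<le> (C * ?x)^2 * (1 / ?x^2 + 1 / ?x) / 2"
      using z by (intro divide_right_mono mult_right_mono) auto
    also have "\<dots> = C^2 / 2 + C^2 / 2 * ?x"
      using z by (simp add: field_simps power2_eq_square)
    finally have e: "(Im z)^2 * (1 / ?x^2 + 1 / ?x) / 2 \<le> C^2 / 2 + C^2 / 2 * ?x" .
    have "norm (rGamma z) \<le> rGamma ?x * exp ((Im z)^2 * (1 / ?x^2 + 1 / ?x) / 2)"
      using z by (intro norm_rGamma_le_Re) auto
    also have "\<dots> \<le> (exp (R + 1) * R powr (1 - ?x)) * exp (C^2 / 2 + C^2 / 2 * ?x)"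
      using e z R by (intro mult_mono rGamma_real_le_powr) auto
    also have "R powr (1 - ?x) = R * R powr (- ?x)"
      using R by (simp add: powr_diff powr_minus field_simps)
    also have "R powr (- ?x) = exp (- (C^2 / 2 * ?x)) * \<rho> powr ?x"
      using assms by (simp add: R_def powr_def ln_div exp_diff exp_minus field_simps flip: exp_add)
    finally show "norm (rGamma z) \<le> exp (R + 1) * R * exp (C^2 / 2) * \<rho> powr ?x"
      by (simp add: exp_add exp_minus mult_ac)
  qed (use R in auto)
qed

text \<open>
  With \<open>a = min (Re \<alpha>) (Re \<beta>)\<close>, the real part of \<open>\<alpha>k + \<beta>l + \<gamma>\<close> grows at least like \<open>a(k+l)\<close> and the
  imaginary part at most linearly in \<open>k+l\<close>. So all but finitely many of these points lie in one
  sector with real part at least \<open>1\<close>, where the previous bound applies; the finitely many exceptions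
  are absorbed into the constant.
\<close>
lemma rGamma_lattice_decay:
  fixes \<alpha> \<beta> \<gamma> :: complex and q :: real
  assumes "Re \<alpha> > 0" "Re \<beta> > 0" and q: "0 < q" "q < 1"
  obtains K where "K > 0"
    "\<And>k l. norm (rGamma (\<alpha> * of_nat k + \<beta> * of_nat l + \<gamma>)) \<le> K * q ^ (k + l)"
proof -
  let ?z = "\<lambda>k l. \<alpha> * of_nat k + \<beta> * of_nat l + \<gamma>"
  define a where "a = min (Re \<alpha>) (Re \<beta>)"
  define s where "s = norm \<alpha> + norm \<beta>"
  define C where "C = 2 * s / a + \<bar>Im \<gamma>\<bar>"
  have a: "a > 0" using assms by (simp add: a_def)
  have C: "C \<ge> 0" using a by (simp add: C_def s_def)
  \<comment> \<open>The base is chosen so that its power with exponent \<open>a(k+l)/2\<close> is exactly \<open>q ^ (k+l)\<close>.\<close>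
  obtain K where K: "K > 0"
    "\<And>z::complex. Re z \<ge> 1 \<Longrightarrow> \<bar>Im z\<bar> \<le> C * Re z \<Longrightarrow> norm (rGamma z) \<le> K * (q powr (2 / a)) powr Re z"
    using rGamma_sector_decay[of "q powr (2 / a)" C] q by auto
  \<comment> \<open>Half of the growth \<open>a(k+l)\<close> is given up to absorb \<open>Re \<gamma>\<close> and reach real part at least \<open>1\<close>.\<close>
  obtain N :: nat where N: "real N \<ge> 2 * (1 - Re \<gamma>) / a"
    using real_arch_simple by blast
  have far: "norm (rGamma (?z k l)) \<le> K * q ^ (k + l)" if kl: "k + l \<ge> N" for k l
  proof -
    have "a * (real k + real l) / 2 \<ge> a * real N / 2"
      using kl a by (simp flip: of_nat_add)
    moreover have "a * real N / 2 \<ge> 1 - Re \<gamma>"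
      using N a by (simp add: field_simps)
    moreover have "Re \<alpha> * real k + Re \<beta> * real l \<ge> a * real k + a * real l"
      by (intro add_mono mult_right_mono) (auto simp: a_def)
    moreover have "Re (?z k l) = Re \<alpha> * real k + Re \<beta> * real l + Re \<gamma>"
      by simp
    moreover have "a * real k + a * real l = 2 * (a * (real k + real l) / 2)"
      by (simp add: algebra_simps)
    ultimately have x: "Re (?z k l) \<ge> a * (real k + real l) / 2 + 1"
      by linarith
    have "\<bar>Im (?z k l)\<bar> \<le> \<bar>Im \<alpha> * real k\<bar> + \<bar>Im \<beta> * real l\<bar> + \<bar>Im \<gamma>\<bar>"
      by simp
    also have "\<dots> \<le> s * real k + s * real l + \<bar>Im \<gamma>\<bar>"
      using abs_Im_le_cmod[of \<alpha>] abs_Im_le_cmod[of \<beta>]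
      by (auto simp: abs_mult s_def intro!: add_mono mult_right_mono intro: order_trans)
    also have "\<dots> \<le> C * (a * (real k + real l) / 2 + 1)"
    proof -
      have "C * (a * (real k + real l) / 2 + 1)
          = s * real k + s * real l + \<bar>Im \<gamma>\<bar> + (2 * s / a + \<bar>Im \<gamma>\<bar> * (a * (real k + real l) / 2))"
        using a by (simp add: C_def field_simps)
      moreover have "2 * s / a + \<bar>Im \<gamma>\<bar> * (a * (real k + real l) / 2) \<ge> 0"
        using a by (intro add_nonneg_nonneg mult_nonneg_nonneg divide_nonneg_pos) (auto simp: s_def)
      ultimately show ?thesis by linarith
    qed
    also have "\<dots> \<le> C * Re (?z k l)"
      by (intro mult_left_mono x C)
    finally have "norm (rGamma (?z k l)) \<le> K * (q powr (2 / a)) powr Re (?z k l)"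
      using x a by (intro K(2)) (auto intro: order_trans[rotated])
    also have "(q powr (2 / a)) powr Re (?z k l) \<le> (q powr (2 / a)) powr (a * (real k + real l) / 2)"
      using q a x by (intro powr_mono') (auto intro!: powr_le1)
    also have "\<dots> = q ^ (k + l)"
      using a q by (simp add: powr_powr flip: of_nat_add powr_realpow)
    finally show ?thesis using K by simp
  qed
  define D where "D = (\<Sum>(k, l)\<in>{..<N}\<times>{..<N}. norm (rGamma (?z k l)) / q ^ (k + l))"
  have D: "D \<ge> 0" unfolding D_def using q by (intro sum_nonneg) auto
  have "norm (rGamma (?z k l)) \<le> (K + D) * q ^ (k + l)" for k l
  proof (cases "k + l \<ge> N")
    case True
    have "K * q ^ (k + l) \<le> (K + D) * q ^ (k + l)"
      using D q by (intro mult_right_mono) auto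
    with far[OF True] show ?thesis by linarith
  next
    case False
    have "norm (rGamma (?z k l)) / q ^ (k + l) \<le> D"
      unfolding D_def using False q member_le_sum[of "(k, l)" "{..<N}\<times>{..<N}"
          "\<lambda>(k, l). norm (rGamma (?z k l)) / q ^ (k + l)"] by auto
    also have "D \<le> K + D" using K by simp
    finally show ?thesis using q by (simp add: field_simps)
  qed
  then show ?thesis using that[of "K + D"] K D by auto
qed

section \<open>The Beta integral with complex exponents\<close>

lemma norm_of_real_powr:
  assumes "x > 0" shows "norm (complex_of_real x powr z) = x powr Re z"
  using assms by (simp add: norm_powr_real_powr)

lemma borel_measurable_of_real_powr [measurable (raw)]:
  assumes [measurable]: "f \<in> borel_measurable M"
  shows "(\<lambda>x. complex_of_real (f x) powr z) \<in> borel_measurable M"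
proof -
  have "(\<lambda>x. complex_of_real (f x) powr z) = (\<lambda>x. if f x = 0 then 0 else
      exp (z * (of_real (ln \<bar>f x\<bar>) + (if f x < 0 then of_real pi else 0) * \<i>)))"
    by (auto simp: powr_def Ln_of_real')
  then show ?thesis by simp
qed

text \<open>
  Fubini's theorem and translation invariance; Fubini applies because the double integral of the
  norms is the product of the two norm integrals.
\<close>
lemma lborel_integral_convolution:
  fixes f g :: "real \<Rightarrow> complex"
  assumes f: "integrable lborel f" and g: "integrable lborel g"
  shows "(\<integral>u. (\<integral>x. f x * g (u - x) \<partial>lborel) \<partial>lborel) = integral\<^sup>L lborel f * integral\<^sup>L lborel g"
proof -
  have [measurable]: "f \<in> borel_measurable borel" "g \<in> borel_measurable borel"
    using f g by (auto dest: borel_measurable_integrable)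
  have shift: "integrable lborel (\<lambda>u. h (u - x))" "(\<integral>u. h (u - x) \<partial>lborel) = integral\<^sup>L lborel h"
    if "integrable lborel h" for h :: "real \<Rightarrow> 'b::{banach, second_countable_topology}" and x
    using lborel_integrable_real_affine[OF that, of 1 "- x"]
      lborel_integral_real_affine[of 1 h "- x"] by simp_all
  have int: "integrable (lborel \<Otimes>\<^sub>M lborel) (\<lambda>(x, u). f x * g (u - x))"
  proof (rule lborel_pair.Fubini_integrable)
    show "integrable lborel (\<lambda>x. \<integral>u. norm (case (x, u) of (x, u) \<Rightarrow> f x * g (u - x)) \<partial>lborel)"
      using f g shift(2)[OF integrable_norm[OF g]] by (simp add: norm_mult)
    show "AE x in lborel. integrable lborel (\<lambda>u. case (x, u) of (x, u) \<Rightarrow> f x * g (u - x))"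
      using shift[OF g] by auto
  qed measurable
  have "(\<integral>u. (\<integral>x. f x * g (u - x) \<partial>lborel) \<partial>lborel) = (\<integral>x. (\<integral>u. f x * g (u - x) \<partial>lborel) \<partial>lborel)"
    using lborel_pair.Fubini_integral[OF int] by simp
  also have "\<dots> = integral\<^sup>L lborel f * integral\<^sup>L lborel g"
    using f g by (simp add: shift)
  finally show ?thesis .
qed

lemma set_integrable_Beta_unit:
  assumes "Re a > 0" "Re b > 0"
  shows "set_integrable lborel {0<..<1} (\<lambda>x. of_real x powr (a - 1) * of_real (1 - x) powr (b - 1) :: complex)"
proof -
  have "set_integrable lborel {0<..<1} (\<lambda>x. x powr (Re a - 1) * (1 - x) powr (Re b - 1))"
    by (rule set_integrable_subset[OF integrable_Beta[of "Re a" "Re b"]]) (use assms in auto)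
  then show ?thesis
    by (rule set_integrable_bound)
       (auto simp: norm_mult norm_of_real_powr set_borel_measurable_def simp del: of_real_diff)
qed

text \<open>
  The substitution \<open>\<xi> = t x\<close> on the level of integrands. The bases are positive reals, which is what
  makes the complex powers multiplicative.
\<close>
lemma Beta_kernel_rescale:
  fixes a b :: complex
  assumes "t > 0" and "x \<in> {0<..<1}"
  shows "of_real (t * x) powr (a - 1) * of_real (t - t * x) powr (b - 1) * of_real t =
    of_real t powr (a + b - 1) * (of_real x powr (a - 1) * of_real (1 - x) powr (b - 1))"
proof -
  have "t - t * x = t * (1 - x)" by (simp add: algebra_simps)
  then have "complex_of_real (t - t * x) powr (b - 1) = of_real t powr (b - 1) * of_real (1 - x) powr (b - 1)"
    using assms by (simp only: of_real_mult) (subst powr_times_real, auto simp del: of_real_diff)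
  moreover have "complex_of_real (t * x) powr (a - 1) = of_real t powr (a - 1) * of_real x powr (a - 1)"
    using assms by (simp add: powr_times_real)
  moreover have "complex_of_real t powr (a + b - 1) = of_real t powr (a - 1) * of_real t powr (b - 1) * of_real t"
    using assms by (simp add: field_simps powr_diff powr_add)
  ultimately show ?thesis by simp
qed

lemma Beta_kernel_scaling:
  fixes a b :: complex
  assumes t: "t > 0"
  defines "B \<equiv> (LINT x:{0<..<1}|lborel. of_real x powr (a - 1) * of_real (1 - x) powr (b - 1))"
  shows "(LINT x:{0<..<t}|lborel. of_real x powr (a - 1) * of_real (t - x) powr (b - 1)) = of_real t powr (a + b - 1) * B"
proof -
  have "(LINT x:{0<..<t}|lborel. of_real x powr (a - 1) * of_real (t - x) powr (b - 1)) =
      (LINT x|lborel. t *\<^sub>R (indicator {0<..<t} (t * x) *\<^sub>R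
        (of_real (t * x) powr (a - 1) * of_real (t - t * x) powr (b - 1))))"
    unfolding set_lebesgue_integral_def
    using t by (subst lborel_integral_real_affine[of t _ 0]) (auto simp del: scaleR_scaleR)
  also have "\<dots> = (LINT x|lborel. of_real t powr (a + b - 1) * (indicator {0<..<1} x *\<^sub>R
        (of_real x powr (a - 1) * of_real (1 - x) powr (b - 1))))"
  proof (rule Bochner_Integration.integral_cong)
    fix x :: real
    have "t * x \<in> {0<..<t} \<longleftrightarrow> x \<in> {0<..<1}"
      using t by (auto simp: zero_less_mult_iff)
    then show "t *\<^sub>R (indicator {0<..<t} (t * x) *\<^sub>R
        (of_real (t * x) powr (a - 1) * of_real (t - t * x) powr (b - 1))) =
        of_real t powr (a + b - 1) * (indicator {0<..<1} x *\<^sub>R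
        (of_real x powr (a - 1) * of_real (1 - x) powr (b - 1)))"
      using Beta_kernel_rescale[OF t, of x a b]
      by (cases "x \<in> {0<..<1}") (auto simp: scaleR_conv_of_real mult_ac simp del: of_real_diff of_real_mult greaterThanLessThan_iff)
  qed simp
  also have "\<dots> = of_real t powr (a + b - 1) * B"
    by (simp only: B_def set_lebesgue_integral_def integral_mult_right_zero)
  finally show ?thesis .
qed

lemma set_integrable_Beta_kernel:
  fixes a b :: complex
  assumes t: "t > 0" and "Re a > 0" "Re b > 0"
  shows "set_integrable lborel {0<..<t} (\<lambda>x. of_real x powr (a - 1) * of_real (t - x) powr (b - 1))"
proof -
  have "integrable lborel (\<lambda>x. indicator {0<..<t} (0 + t * x) *\<^sub>R
        (complex_of_real (0 + t * x) powr (a - 1) * of_real (t - (0 + t * x)) powr (b - 1)))"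
  proof -
    have "integrable lborel (\<lambda>x. of_real t powr (a + b - 1) / of_real t * (indicator {0<..<1} x *\<^sub>R
        (complex_of_real x powr (a - 1) * of_real (1 - x) powr (b - 1))))"
      using set_integrable_Beta_unit[of a b] assms unfolding set_integrable_def
      by (intro integrable_mult_right) auto
    also have "?this \<longleftrightarrow> ?thesis"
    proof (rule Bochner_Integration.integrable_cong)
      fix x :: real
      have "t * x \<in> {0<..<t} \<longleftrightarrow> x \<in> {0<..<1}"
        using t by (auto simp: zero_less_mult_iff)
      then show "of_real t powr (a + b - 1) / of_real t * (indicator {0<..<1} x *\<^sub>R
        (complex_of_real x powr (a - 1) * of_real (1 - x) powr (b - 1))) = indicator {0<..<t} (0 + t * x) *\<^sub>R
        (complex_of_real (0 + t * x) powr (a - 1) * of_real (t - (0 + t * x)) powr (b - 1))"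
        using Beta_kernel_rescale[OF t, of x a b] t
        by (cases "x \<in> {0<..<1}") (auto simp: scaleR_conv_of_real field_simps simp del: of_real_diff of_real_mult greaterThanLessThan_iff)
    qed simp
    finally show ?thesis .
  qed
  then show ?thesis
    unfolding set_integrable_def by (subst (asm) lborel_integrable_real_affine_iff) (use t in auto)
qed

text \<open>
  Euler's argument: with \<open>G\<^sub>s(x) = x\<^bsup>s-1\<^esup> exp (-x)\<close> on the positive axis, the convolution of \<open>G\<^sub>a\<close>
  and \<open>G\<^sub>b\<close> is \<open>B\<close> times \<open>G\<close> with index \<open>a + b\<close>, where \<open>B\<close> is the Beta integral over the unit
  interval. Integrating gives \<open>\<Gamma>(a) \<Gamma>(b) = B \<Gamma>(a+b)\<close>.
\<close>
lemma integral_Beta_kernel: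
  fixes a b :: complex
  assumes a: "Re a > 0" and b: "Re b > 0" and t: "t > 0"
  shows "(LINT x:{0<..<t}|lborel. of_real x powr (a - 1) * of_real (t - x) powr (b - 1)) =
    of_real t powr (a + b - 1) * Gamma a * Gamma b * rGamma (a + b)"
proof -
  define G :: "complex \<Rightarrow> real \<Rightarrow> complex"
    where "G = (\<lambda>s x. indicator {0<..} x *\<^sub>R (of_real x powr (s - 1) / of_real (exp x)))"
  define B :: complex
    where "B = (LINT x:{0<..<1}|lborel. of_real x powr (a - 1) * of_real (1 - x) powr (b - 1))"
  have Gamma: "integrable lborel (G s) \<and> integral\<^sup>L lborel (G s) = Gamma s" if s: "Re s > 0" for s
  proof -
    have [measurable]: "G s \<in> borel_measurable borel" by (simp add: G_def)
    have i: "integrable lebesgue (G s)"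
      using absolutely_integrable_Gamma_integral'[OF s]
      by (simp add: absolutely_integrable_on_def set_integrable_def G_def)
    have "integral\<^sup>L lebesgue (G s) = Gamma s"
      using set_lebesgue_integral_eq_integral(2)[OF absolutely_integrable_Gamma_integral'[OF s]]
        Gamma_integral_complex'[OF s]
      by (simp add: set_lebesgue_integral_def G_def has_integral_iff)
    with i show ?thesis
      by (simp add: integrable_completion integral_completion)
  qed
  have conv: "(\<integral>x. G a x * G b (u - x) \<partial>lborel) = B * G (a + b) u" for u
  proof (cases "u > 0")
    case True
    have "(\<integral>x. G a x * G b (u - x) \<partial>lborel) =
        (\<integral>x. (indicator {0<..<u} x *\<^sub>R (of_real x powr (a - 1) * of_real (u - x) powr (b - 1))) / of_real (exp u) \<partial>lborel)"
      by (rule Bochner_Integration.integral_cong)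
         (auto simp: G_def indicator_def exp_diff simp del: of_real_diff)
    also have "\<dots> = of_real u powr (a + b - 1) * B / of_real (exp u)"
      using Beta_kernel_scaling[OF True, of a b] by (simp add: set_lebesgue_integral_def B_def)
    finally show ?thesis using True by (simp add: G_def)
  next
    case False
    then have "(\<lambda>x. G a x * G b (u - x)) = (\<lambda>x. 0)" by (auto simp: G_def indicator_def)
    then have "(\<integral>x. G a x * G b (u - x) \<partial>lborel) = 0" by simp
    with False show ?thesis by (simp add: G_def)
  qed
  have "Gamma a * Gamma b = (\<integral>u. B * G (a + b) u \<partial>lborel)"
    using lborel_integral_convolution[of "G a" "G b"] Gamma[OF a] Gamma[OF b] by (simp add: conv)
  also have "\<dots> = B * Gamma (a + b)"
    using Gamma[of "a + b"] a b by simp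
  finally have "Gamma a * Gamma b * rGamma (a + b) = B * (Gamma (a + b) * rGamma (a + b))"
    by simp
  moreover have "a + b \<notin> \<int>\<^sub>\<le>\<^sub>0"
    using a b by (auto elim!: nonpos_Ints_cases simp: complex_eq_iff)
  then have "Gamma (a + b) * rGamma (a + b) = 1"
    by (simp add: Gamma_def rGamma_eq_zero_iff)
  ultimately show ?thesis
    using Beta_kernel_scaling[OF t, of a b] by (simp add: B_def mult_ac)
qed

section \<open>Normalised powers under integration and differentiation\<close>

text \<open>
  Using the entire function \<open>1/\<Gamma>\<close> as the normalisation lets the index \<open>s\<close> be any complex number,
  including the poles of \<open>\<Gamma>\<close>, so that repeated differentiation never leaves the family.
\<close>
definition RL_power :: "complex \<Rightarrow> real \<Rightarrow> complex" where
  "RL_power s t = of_real t powr (s - 1) * rGamma s"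

lemma has_vector_derivative_RL_power:
  assumes "t > 0"
  shows "(RL_power (s + 1) has_vector_derivative RL_power s t) (at t)"
proof -
  have "((\<lambda>z. z powr s) has_field_derivative s * of_real t powr (s - 1)) (at (of_real t))"
    using assms by (intro has_field_derivative_powr) (auto simp: complex_nonpos_Reals_iff)
  then have "((\<lambda>t. of_real t powr s) has_vector_derivative s * of_real t powr (s - 1)) (at t)"
    by (rule has_vector_derivative_real_field)
  from has_vector_derivative_mult_left[OF this, of "rGamma (s + 1)"]
  have "(RL_power (s + 1) has_vector_derivative of_real t powr (s - 1) * (s * rGamma (s + 1))) (at t)"
    by (simp add: RL_power_def[abs_def] mult_ac)
  then show ?thesis
    by (simp only: rGamma_plus1 RL_power_def)
qed

lemma norm_RL_power: "t > 0 \<Longrightarrow> norm (RL_power s t) = t powr (Re s - 1) * norm (rGamma s)"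
  by (simp add: RL_power_def norm_mult norm_of_real_powr)

text \<open>
  Riemann--Liouville integration shifts the index by the order. The integral is stated without the
  prefactor \<open>1/\<Gamma>(\<mu>)\<close>, the form in which it is summed over the series.
\<close>
lemma RL_power_integral:
  assumes "Re \<mu> > 0" "Re s > 0" "t > 0"
  shows "set_integrable lborel {0<..<t} (RL_integrand \<mu> (RL_power s) t)"
    and "(LINT \<xi>:{0<..<t}|lborel. RL_integrand \<mu> (RL_power s) t \<xi>) = Gamma \<mu> * RL_power (s + \<mu>) t"
proof -
  have eq: "RL_integrand \<mu> (RL_power s) t =
      (\<lambda>\<xi>. rGamma s * (of_real \<xi> powr (s - 1) * of_real (t - \<xi>) powr (\<mu> - 1)))"
    by (simp add: RL_integrand_def[abs_def] RL_power_def mult_ac)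
  show "set_integrable lborel {0<..<t} (RL_integrand \<mu> (RL_power s) t)"
    unfolding eq by (rule set_integrable_mult_right) (rule set_integrable_Beta_kernel[OF assms(3,2,1)])
  have "s \<notin> \<int>\<^sub>\<le>\<^sub>0" using assms by (auto elim!: nonpos_Ints_cases)
  then have "rGamma s * Gamma s = 1" by (simp add: rGamma_inverse_Gamma Gamma_eq_zero_iff)
  then show "(LINT \<xi>:{0<..<t}|lborel. RL_integrand \<mu> (RL_power s) t \<xi>) = Gamma \<mu> * RL_power (s + \<mu>) t"
    unfolding eq set_integral_mult_right integral_Beta_kernel[OF assms(2,1,3)]
    by (simp add: RL_power_def)
qed

section \<open>The double series and its majorant\<close>

text \<open>
  For \<open>\<delta> = 1\<close> the Pochhammer symbol is \<open>(k+l)!\<close>, which turns the coefficient into a binomial one.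
\<close>
definition ml_coeff :: "complex \<Rightarrow> complex \<Rightarrow> nat \<times> nat \<Rightarrow> complex" where
  "ml_coeff x y p = of_nat ((fst p + snd p) choose fst p) * x ^ fst p * y ^ snd p"

definition ml_exponent :: "complex \<Rightarrow> complex \<Rightarrow> complex \<Rightarrow> nat \<times> nat \<Rightarrow> complex" where
  "ml_exponent \<alpha> \<beta> \<gamma> p = \<alpha> * of_nat (fst p) + \<beta> * of_nat (snd p) + \<gamma>"

definition ml_term :: "complex \<Rightarrow> complex \<Rightarrow> complex \<Rightarrow> complex \<Rightarrow> complex \<Rightarrow> nat \<times> nat \<Rightarrow> real \<Rightarrow> complex" where
  "ml_term x y \<alpha> \<beta> \<gamma> p t = ml_coeff x y p * RL_power (ml_exponent \<alpha> \<beta> \<gamma> p) t"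

definition ml_series :: "complex \<Rightarrow> complex \<Rightarrow> complex \<Rightarrow> complex \<Rightarrow> complex \<Rightarrow> real \<Rightarrow> complex" where
  "ml_series x y \<alpha> \<beta> \<gamma> t = infsum (\<lambda>p. ml_term x y \<alpha> \<beta> \<gamma> p t) UNIV"

text \<open>
  The summable majorant on the index set. The ratio \<open>1/2\<close> is arbitrary, since the terms of the
  series decay faster than geometrically.
\<close>
definition half_weight :: "nat \<times> nat \<Rightarrow> real" where
  "half_weight p = (1/2) ^ (fst p + snd p)"

lemma half_weight_nonneg: "half_weight p \<ge> 0"
  by (simp add: half_weight_def)

lemma summable_half_weight: "half_weight summable_on UNIV"
proof -
  have g: "((\<lambda>l. (1/2::real) ^ l) has_sum 2) UNIV"
    using sums_nonneg_imp_has_sum[of "\<lambda>l. (1/2::real) ^ l" 2] geometric_sums[of "1/2::real"] by simp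
  have "half_weight summable_on (SIGMA k:UNIV. UNIV)"
  proof (rule summable_on_SigmaI)
    show "((\<lambda>l. half_weight (k, l)) has_sum (1/2) ^ k * 2) UNIV" for k
      using has_sum_cmult_right[OF g, of "(1/2) ^ k"] by (simp add: half_weight_def power_add)
    show "(\<lambda>k. (1/2::real) ^ k * 2) summable_on UNIV"
      using g by (intro summable_on_cmult_left) (auto simp: summable_on_def)
  qed (simp add: half_weight_nonneg)
  then show ?thesis by simp
qed

lemma summable_half_weight_nat: "summable (\<lambda>m. half_weight (prod_decode m))"
  using summable_half_weight summable_on_reindex_bij_betw[OF bij_prod_decode, of half_weight]
  by (intro summable_on_imp_summable) simp

lemma norm_ml_coeff_le: "norm (ml_coeff x y p) \<le> (2 * (norm x + norm y + 1)) ^ (fst p + snd p)"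
proof -
  let ?X = "norm x + norm y + 1" and ?n = "fst p + snd p"
  have "norm (ml_coeff x y p) = real (?n choose fst p) * (norm x ^ fst p * norm y ^ snd p)"
    by (simp add: ml_coeff_def norm_mult norm_power)
  also have "\<dots> \<le> 2 ^ ?n * (?X ^ fst p * ?X ^ snd p)"
  proof (intro mult_mono power_mono)
    show "real (?n choose fst p) \<le> 2 ^ ?n"
      using binomial_le_pow2[of ?n "fst p"] by (metis of_nat_le_iff of_nat_numeral of_nat_power)
  qed auto
  also have "\<dots> = (2 * ?X) ^ ?n"
    by (simp only: power_mult_distrib power_add mult_ac)
  finally show ?thesis .
qed

lemma powr_ml_exponent:
  assumes "t > 0"
  shows "t powr (Re (ml_exponent \<alpha> \<beta> \<gamma> p) - 1) =
    (t powr Re \<alpha>) ^ fst p * (t powr Re \<beta>) ^ snd p * t powr (Re \<gamma> - 1)"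
proof -
  have "Re (ml_exponent \<alpha> \<beta> \<gamma> p) - 1 = Re \<alpha> * real (fst p) + Re \<beta> * real (snd p) + (Re \<gamma> - 1)"
    by (simp add: ml_exponent_def)
  moreover have "t powr (c * real k) = (t powr c) ^ k" for c k
  proof -
    have "t powr (c * real k) = (t powr c) powr real k" by (rule powr_powr[symmetric])
    also have "\<dots> = (t powr c) ^ k" by (rule powr_realpow) (use assms in simp)
    finally show ?thesis .
  qed
  ultimately show ?thesis by (simp only: powr_add)
qed

text \<open>
  Termwise differentiation: the Weierstrass M-test makes the series of derivatives converge
  uniformly.
\<close>
lemma has_vector_derivative_suminf:
  fixes f f' :: "nat \<Rightarrow> real \<Rightarrow> 'a::banach"
  assumes S: "open S" "convex S"
    and f': "\<And>n x. x \<in> S \<Longrightarrow> (f n has_vector_derivative f' n x) (at x)"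
    and M: "\<And>n x. x \<in> S \<Longrightarrow> norm (f' n x) \<le> M n" "summable M"
    and g: "\<And>x. x \<in> S \<Longrightarrow> (\<lambda>n. f n x) sums g x"
    and x: "x \<in> S"
  shows "(g has_vector_derivative (\<Sum>n. f' n x)) (at x)"
proof -
  have lim: "uniform_limit S (\<lambda>n x. \<Sum>i<n. f' i x) (\<lambda>x. \<Sum>n. f' n x) sequentially"
    by (rule Weierstrass_m_test[OF M])
  have "\<exists>g. \<forall>x\<in>S. (\<lambda>n. f n x) sums g x \<and> (g has_derivative (\<lambda>h. h *\<^sub>R (\<Sum>n. f' n x))) (at x within S)"
  proof (rule has_derivative_series[where f = f and f' = "\<lambda>n x h. h *\<^sub>R f' n x" and x = x and l = "g x"])
    show "(f n has_derivative (\<lambda>h. h *\<^sub>R f' n x)) (at x within S)" if "x \<in> S" for n x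
      using has_vector_derivative_at_within[OF f'[OF that], of n S]
      by (simp add: has_vector_derivative_def)
  next
    fix e :: real assume "e > 0"
    have "\<forall>\<^sub>F n in sequentially. \<forall>x\<in>S. norm ((\<Sum>i<n. f' i x) - (\<Sum>n. f' n x)) < e"
      using uniform_limitD[OF lim \<open>e > 0\<close>] by (simp add: dist_norm)
    then show "\<forall>\<^sub>F n in sequentially. \<forall>x\<in>S. \<forall>h. norm ((\<Sum>i<n. h *\<^sub>R f' i x) - h *\<^sub>R (\<Sum>n. f' n x)) \<le> e * norm h"
    proof eventually_elim
      case (elim n)
      show ?case
      proof (intro ballI allI)
        fix x h assume "x \<in> S"
        have "(\<Sum>i<n. h *\<^sub>R f' i x) - h *\<^sub>R (\<Sum>n. f' n x) = h *\<^sub>R ((\<Sum>i<n. f' i x) - (\<Sum>n. f' n x))"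
          by (simp only: scaleR_sum_right scaleR_diff_right)
        moreover have "norm h * norm ((\<Sum>i<n. f' i x) - (\<Sum>n. f' n x)) \<le> norm h * e"
          using elim \<open>x \<in> S\<close> by (intro mult_left_mono) (auto intro: less_imp_le)
        ultimately show "norm ((\<Sum>i<n. h *\<^sub>R f' i x) - h *\<^sub>R (\<Sum>n. f' n x)) \<le> e * norm h"
          by (simp add: mult.commute)
      qed
    qed
  qed (fact S(2) x g[OF x])+
  then obtain g' where g': "\<forall>x\<in>S. (\<lambda>n. f n x) sums g' x \<and>
      (g' has_vector_derivative (\<Sum>n. f' n x)) (at x within S)"
    unfolding has_vector_derivative_def by (rule exE)
  have "(g' has_vector_derivative (\<Sum>n. f' n x)) (at x)"
    using bspec[OF g' x] at_within_open[OF x S(1)] by simp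
  moreover have "g' y = g y" if "y \<in> S" for y
    using bspec[OF g' that] g[OF that] by (auto intro: sums_unique2)
  ultimately show ?thesis
    by (rule has_vector_derivative_transform_within_open[OF _ S(1) x])
qed

text \<open>
  Pascal's rule \<open>c(k,l) = x c(k-1,l) + y c(k,l-1)\<close> away from the origin, summed against an arbitrary
  function \<open>h\<close>. The coefficients are split into the term at the origin (\<open>e\<close>), the part coming from
  the left neighbour (\<open>a\<close>) and the part coming from the lower neighbour (\<open>b\<close>); shifting the index in
  the last two gives the assumed sums.
\<close>
lemma has_sum_ml_coeff_pascal:
  fixes h :: "nat \<Rightarrow> nat \<Rightarrow> complex"
  assumes A: "((\<lambda>p. ml_coeff x y p * h (Suc (fst p)) (snd p)) has_sum A) UNIV"
    and B: "((\<lambda>p. ml_coeff x y p * h (fst p) (Suc (snd p))) has_sum B) UNIV"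
  shows "((\<lambda>p. ml_coeff x y p * h (fst p) (snd p)) has_sum (h 0 0 + x * A + y * B)) UNIV"
proof -
  define a where "a = (\<lambda>p. (if fst p = 0 then 0 else x * ml_coeff x y (fst p - 1, snd p)) * h (fst p) (snd p))"
  define b where "b = (\<lambda>p. (if snd p = 0 then 0 else y * ml_coeff x y (fst p, snd p - 1)) * h (fst p) (snd p))"
  define e where "e = (\<lambda>p::nat \<times> nat. if p = (0, 0) then h 0 0 else 0)"
  have "((\<lambda>p. x * (ml_coeff x y p * h (Suc (fst p)) (snd p))) has_sum x * A) UNIV"
    by (intro has_sum_cmult_right A)
  also have "(\<lambda>p. x * (ml_coeff x y p * h (Suc (fst p)) (snd p))) = a \<circ> map_prod Suc id"
    by (auto simp: a_def fun_eq_iff)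
  finally have aR: "(a has_sum x * A) (range (map_prod Suc id))"
    by (subst has_sum_reindex) (auto intro: prod.inj_map simp: o_def)
  have a0: "a p = 0" if "p \<notin> range (map_prod Suc id)" for p
  proof (cases "fst p")
    case (Suc n)
    then have "p = map_prod Suc id (n, snd p)"
      by (cases p) simp
    with that show ?thesis by blast
  qed (simp add: a_def)
  have "(a has_sum x * A) UNIV \<longleftrightarrow> (a has_sum x * A) (range (map_prod Suc id))"
    by (rule has_sum_cong_neutral) (use a0 in auto)
  with aR have a: "(a has_sum x * A) UNIV" by simp
  have "((\<lambda>p. y * (ml_coeff x y p * h (fst p) (Suc (snd p)))) has_sum y * B) UNIV"
    by (intro has_sum_cmult_right B)
  also have "(\<lambda>p. y * (ml_coeff x y p * h (fst p) (Suc (snd p)))) = b \<circ> map_prod id Suc"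
    by (auto simp: b_def fun_eq_iff)
  finally have bR: "(b has_sum y * B) (range (map_prod id Suc))"
    by (subst has_sum_reindex) (auto intro: prod.inj_map simp: o_def)
  have b0: "b p = 0" if "p \<notin> range (map_prod id Suc)" for p
  proof (cases "snd p")
    case (Suc n)
    then have "p = map_prod id Suc (fst p, n)"
      by (cases p) simp
    with that show ?thesis by blast
  qed (simp add: b_def)
  have "(b has_sum y * B) UNIV \<longleftrightarrow> (b has_sum y * B) (range (map_prod id Suc))"
    by (rule has_sum_cong_neutral) (use b0 in auto)
  with bR have b: "(b has_sum y * B) UNIV" by simp
  have "(e has_sum h 0 0) {(0, 0)}"
    using has_sum_finite[of "{(0, 0)}" e] by (simp add: e_def)
  moreover have "(e has_sum h 0 0) UNIV \<longleftrightarrow> (e has_sum h 0 0) {(0, 0)}"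
    by (rule has_sum_cong_neutral) (auto simp: e_def)
  ultimately have e: "(e has_sum h 0 0) UNIV" by simp
  have "ml_coeff x y p * h (fst p) (snd p) = e p + a p + b p" for p
  proof (cases p)
    case (Pair k l)
    then show ?thesis
      by (cases k; cases l) (auto simp: e_def a_def b_def ml_coeff_def algebra_simps)
  qed
  with has_sum_add[OF has_sum_add[OF e a] b] show ?thesis by simp
qed

context
  fixes \<alpha> \<beta> :: complex
  assumes \<alpha>: "Re \<alpha> > 0" and \<beta>: "Re \<beta> > 0"
begin

text \<open>
  The power of \<open>t\<close> that does not grow with \<open>(k,l)\<close> is kept explicit, so that the bound is integrable
  near \<open>0\<close> when \<open>Re \<gamma> > 0\<close>, and also serves uniformly on compact subsets of the open half-line.
\<close>
lemma ml_term_bound: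
  assumes "T > 0"
  obtains K where "K > 0"
    "\<And>p t. 0 < t \<Longrightarrow> t \<le> T \<Longrightarrow> norm (ml_term x y \<alpha> \<beta> \<gamma> p t) \<le> K * half_weight p * t powr (Re \<gamma> - 1)"
proof -
  \<comment> \<open>One factor \<open>X * Y\<close> per step covers coefficients and powers; the decay rate \<open>1/(2XY)\<close> then leaves \<open>1/2\<close>.\<close>
  define X where "X = 2 * (norm x + norm y + 1)"
  define Y where "Y = T powr Re \<alpha> + T powr Re \<beta> + 1"
  have X: "X \<ge> 2" and Y: "Y \<ge> 1" by (auto simp: X_def Y_def)
  have XY: "2 * 1 \<le> X * Y" using X Y by (intro mult_mono) auto
  obtain K where K: "K > 0"
    "\<And>k l. norm (rGamma (\<alpha> * of_nat k + \<beta> * of_nat l + \<gamma>)) \<le> K * (1 / (2 * (X * Y))) ^ (k + l)"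
    using rGamma_lattice_decay[OF \<alpha> \<beta>, of "1 / (2 * (X * Y))" \<gamma>] XY by auto
  have "norm (ml_term x y \<alpha> \<beta> \<gamma> p t) \<le> K * half_weight p * t powr (Re \<gamma> - 1)"
    if t: "0 < t" "t \<le> T" for p t
  proof -
    let ?n = "fst p + snd p"
    have "(t powr Re \<alpha>) ^ fst p * (t powr Re \<beta>) ^ snd p \<le> Y ^ fst p * Y ^ snd p"
    proof (intro mult_mono power_mono)
      show "t powr Re \<alpha> \<le> Y" "t powr Re \<beta> \<le> Y"
        using t \<alpha> \<beta> powr_mono2[of "Re \<alpha>" t T] powr_mono2[of "Re \<beta>" t T]
        by (auto simp: Y_def intro: order_trans add_increasing add_increasing2)
    qed (use Y in auto)
    then have pow: "t powr (Re (ml_exponent \<alpha> \<beta> \<gamma> p) - 1) \<le> Y ^ ?n * t powr (Re \<gamma> - 1)"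
      using t by (simp add: powr_ml_exponent power_add mult_right_mono)
    have "norm (ml_term x y \<alpha> \<beta> \<gamma> p t) =
        norm (ml_coeff x y p) * (t powr (Re (ml_exponent \<alpha> \<beta> \<gamma> p) - 1) * norm (rGamma (ml_exponent \<alpha> \<beta> \<gamma> p)))"
      using t by (simp add: ml_term_def norm_mult norm_RL_power)
    also have "\<dots> \<le> X ^ ?n * ((Y ^ ?n * t powr (Re \<gamma> - 1)) * (K * (1 / (2 * (X * Y))) ^ ?n))"
      using pow K(2)[of "fst p" "snd p"] norm_ml_coeff_le[of x y p] X Y
      by (intro mult_mono) (auto simp: X_def ml_exponent_def)
    also have "\<dots> = K * (X * Y * (1 / (2 * (X * Y)))) ^ ?n * t powr (Re \<gamma> - 1)"
      by (simp only: power_mult_distrib mult_ac)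
    also have "X * Y * (1 / (2 * (X * Y))) = 1 / 2"
      using X Y by simp
    finally show ?thesis by (simp add: half_weight_def)
  qed
  with K(1) that show ?thesis by blast
qed

lemma ml_term_summable:
  assumes "t > 0"
  shows "(\<lambda>p. norm (ml_term x y \<alpha> \<beta> \<gamma> p t)) summable_on UNIV"
proof -
  obtain K where K: "K > 0"
    "\<And>p s. 0 < s \<Longrightarrow> s \<le> t \<Longrightarrow> norm (ml_term x y \<alpha> \<beta> \<gamma> p s) \<le> K * half_weight p * s powr (Re \<gamma> - 1)"
    using ml_term_bound[OF assms, of x y \<gamma>] by blast
  have "(\<lambda>p. K * t powr (Re \<gamma> - 1) * half_weight p) summable_on UNIV"
    by (rule summable_on_cmult_right[OF summable_half_weight])
  then show ?thesis
    by (rule Infinite_Sum.abs_summable_on_comparison_test') (use K(2)[OF assms order_refl] in \<open>simp add: mult_ac\<close>)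
qed

lemma has_sum_ml_series:
  assumes "t > 0"
  shows "((\<lambda>p. ml_term x y \<alpha> \<beta> \<gamma> p t) has_sum ml_series x y \<alpha> \<beta> \<gamma> t) UNIV"
  unfolding ml_series_def
  by (rule has_sum_infsum[OF Infinite_Sum.abs_summable_summable[OF ml_term_summable[OF assms]]])

text \<open>
  The same series enumerated by natural numbers, which is the form needed to interchange it with
  derivatives and Lebesgue integrals.
\<close>
lemma sums_ml_series:
  assumes "t > 0"
  shows "(\<lambda>m. ml_term x y \<alpha> \<beta> \<gamma> (prod_decode m) t) sums ml_series x y \<alpha> \<beta> \<gamma> t"
  using has_sum_ml_series[OF assms, of x y \<gamma>]
    has_sum_reindex_bij_betw[OF bij_prod_decode, of "\<lambda>p. ml_term x y \<alpha> \<beta> \<gamma> p t"]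
  by (intro has_sum_imp_sums) metis

section \<open>Termwise differentiation and integration\<close>

lemma has_vector_derivative_ml_series:
  assumes t: "t > 0"
  shows "(ml_series x y \<alpha> \<beta> (\<gamma> + 1) has_vector_derivative ml_series x y \<alpha> \<beta> \<gamma> t) (at t)"
proof -
  let ?f = "\<lambda>\<gamma> m. ml_term x y \<alpha> \<beta> \<gamma> (prod_decode m)"
  define C where "C = (t/2) powr (Re \<gamma> - 1) + (2*t) powr (Re \<gamma> - 1)"
  obtain K where K: "K > 0"
    "\<And>p s. 0 < s \<Longrightarrow> s \<le> 2*t \<Longrightarrow> norm (ml_term x y \<alpha> \<beta> \<gamma> p s) \<le> K * half_weight p * s powr (Re \<gamma> - 1)"
    using ml_term_bound[of "2*t" x y \<gamma>] t by auto
  have "(ml_series x y \<alpha> \<beta> (\<gamma> + 1) has_vector_derivative (\<Sum>m. ?f \<gamma> m t)) (at t)"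
  proof (rule has_vector_derivative_suminf)
    show "open {t/2<..<2*t}" "convex {t/2<..<2*t}" "t \<in> {t/2<..<2*t}"
      using t by auto
    show "summable (\<lambda>m. K * half_weight (prod_decode m) * C)"
      by (intro summable_mult summable_mult2 summable_half_weight_nat)
    fix s assume s: "s \<in> {t/2<..<2*t}"
    then have s0: "s > 0" using t by auto
    show "(?f (\<gamma> + 1) m has_vector_derivative ?f \<gamma> m s) (at s)" for m
    proof -
      have "ml_exponent \<alpha> \<beta> (\<gamma> + 1) p = ml_exponent \<alpha> \<beta> \<gamma> p + 1" for p
        by (simp add: ml_exponent_def)
      then show ?thesis
        unfolding ml_term_def[abs_def]
        using has_vector_derivative_mult_right[OF has_vector_derivative_RL_power[OF s0]] by simp
    qed
    show "(\<lambda>m. ?f (\<gamma> + 1) m s) sums ml_series x y \<alpha> \<beta> (\<gamma> + 1) s"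
      by (rule sums_ml_series[OF s0])
    show "norm (?f \<gamma> m s) \<le> K * half_weight (prod_decode m) * C" for m
    proof -
      have "s powr (Re \<gamma> - 1) \<le> C"
      proof (cases "Re \<gamma> - 1 \<ge> 0")
        case True
        then have "s powr (Re \<gamma> - 1) \<le> (2*t) powr (Re \<gamma> - 1)"
          using s s0 by (intro powr_mono2) auto
        then show ?thesis by (simp add: C_def add_increasing)
      next
        case False
        then have "s powr (Re \<gamma> - 1) \<le> (t/2) powr (Re \<gamma> - 1)"
          using s t by (intro powr_mono2') auto
        then show ?thesis by (simp add: C_def add_increasing2)
      qed
      then have "K * half_weight (prod_decode m) * s powr (Re \<gamma> - 1) \<le> K * half_weight (prod_decode m) * C"
        using K(1) half_weight_nonneg by (intro mult_left_mono mult_nonneg_nonneg) auto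
      with K(2)[OF s0, of "prod_decode m"] s show ?thesis by auto
    qed
  qed
  also have "(\<Sum>m. ?f \<gamma> m t) = ml_series x y \<alpha> \<beta> \<gamma> t"
    using sums_ml_series[OF t, of x y \<gamma>] by (rule sums_unique[symmetric])
  finally show ?thesis .
qed

text \<open>
  Dominated termwise integration. Each integrand is bounded by a summable weight times the one Beta
  kernel with exponents \<open>Re \<gamma> - 1\<close> and \<open>Re \<mu> - 1\<close>, integrable because both real parts are positive.
  The function \<open>u\<close> is only known on the open half-line, which is all that the integral sees.
\<close>
lemma RL_integral_ml_series:
  assumes \<mu>: "Re \<mu> > 0" and \<gamma>: "Re \<gamma> > 0" and t: "t > 0"
    and u: "\<And>t. t > 0 \<Longrightarrow> u t = ml_series x y \<alpha> \<beta> \<gamma> t"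
  shows "set_integrable lborel {0<..<t} (RL_integrand \<mu> u t)"
    and "RL_integral 0 \<mu> u t = ml_series x y \<alpha> \<beta> (\<gamma> + \<mu>) t"
proof -
  let ?p = prod_decode
  define s where "s = (\<lambda>m. ml_exponent \<alpha> \<beta> \<gamma> (?p m))"
  define h where "h = (\<lambda>m \<xi>. indicator {0<..<t} \<xi> *\<^sub>R RL_integrand \<mu> (ml_term x y \<alpha> \<beta> \<gamma> (?p m)) t \<xi>)"
  \<comment> \<open>The real Beta kernel, written as a norm so that its integrability is that of the complex one.\<close>
  define P where "P = (\<lambda>\<xi>. norm (indicator {0<..<t} \<xi> *\<^sub>R
      (of_real \<xi> powr (\<gamma> - 1) * of_real (t - \<xi>) powr (\<mu> - 1) :: complex)))"
  obtain K where K: "K > 0"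
    "\<And>p s. 0 < s \<Longrightarrow> s \<le> t \<Longrightarrow> norm (ml_term x y \<alpha> \<beta> \<gamma> p s) \<le> K * half_weight p * s powr (Re \<gamma> - 1)"
    using ml_term_bound[OF t, of x y \<gamma>] by blast
  have P: "integrable lborel P"
    using set_integrable_Beta_kernel[OF t \<gamma> \<mu>] unfolding P_def set_integrable_def by (rule integrable_norm)
  have h_eq: "h m \<xi> = ml_coeff x y (?p m) * (indicator {0<..<t} \<xi> *\<^sub>R RL_integrand \<mu> (RL_power (s m)) t \<xi>)" for m \<xi>
    by (simp add: h_def RL_integrand_def ml_term_def s_def)
  have s: "Re (s m) > 0" for m
    using \<alpha> \<beta> \<gamma> by (simp add: s_def ml_exponent_def add_nonneg_pos)
  have h: "integrable lborel (h m)" for m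
    unfolding h_eq[abs_def] using RL_power_integral(1)[OF \<mu> s t]
    by (intro integrable_mult_right) (simp add: set_integrable_def)
  have h_int: "integral\<^sup>L lborel (h m) = Gamma \<mu> * ml_term x y \<alpha> \<beta> (\<gamma> + \<mu>) (?p m) t" for m
  proof -
    have "integral\<^sup>L lborel (h m) = ml_coeff x y (?p m) * (Gamma \<mu> * RL_power (s m + \<mu>) t)"
      using RL_power_integral(2)[OF \<mu> s t, of m]
      unfolding h_eq[abs_def] integral_mult_right_zero set_lebesgue_integral_def by simp
    then show ?thesis by (simp add: ml_term_def s_def ml_exponent_def add_ac)
  qed
  have bound: "norm (h m \<xi>) \<le> K * P \<xi> * half_weight (?p m)" for m \<xi>
  proof (cases "\<xi> \<in> {0<..<t}")
    case True
    then have "norm (h m \<xi>) = norm (complex_of_real (t - \<xi>) powr (\<mu> - 1)) * norm (ml_term x y \<alpha> \<beta> \<gamma> (?p m) \<xi>)"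
      by (simp add: h_def RL_integrand_def norm_mult)
    also have "\<dots> \<le> norm (complex_of_real (t - \<xi>) powr (\<mu> - 1)) * (K * half_weight (?p m) * \<xi> powr (Re \<gamma> - 1))"
      using True by (intro mult_left_mono K) auto
    also have "\<dots> = K * P \<xi> * half_weight (?p m)"
      using True by (simp add: P_def norm_mult norm_of_real_powr)
    finally show ?thesis .
  qed (simp add: h_def P_def)
  have "summable (\<lambda>m. norm (h m \<xi>))" for \<xi>
    by (rule summable_comparison_test'[OF summable_mult[OF summable_half_weight_nat, of "K * P \<xi>"]])
       (use bound in auto)
  then have ae: "AE \<xi> in lborel. summable (\<lambda>m. norm (h m \<xi>))" by simp
  have l1: "summable (\<lambda>m. \<integral>\<xi>. norm (h m \<xi>) \<partial>lborel)"
  proof (rule summable_comparison_test'[OF summable_mult[OF summable_half_weight_nat, of "K * integral\<^sup>L lborel P"]])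
    fix m
    have "(\<integral>\<xi>. norm (h m \<xi>) \<partial>lborel) \<le> (\<integral>\<xi>. K * P \<xi> * half_weight (?p m) \<partial>lborel)"
      using h P bound by (intro integral_mono) auto
    also have "\<dots> = K * integral\<^sup>L lborel P * half_weight (?p m)" by simp
    finally show "norm (\<integral>\<xi>. norm (h m \<xi>) \<partial>lborel) \<le> K * integral\<^sup>L lborel P * half_weight (?p m)"
      by simp
  qed
  have lim: "(\<Sum>m. h m \<xi>) = indicator {0<..<t} \<xi> *\<^sub>R RL_integrand \<mu> u t \<xi>" for \<xi>
  proof (cases "\<xi> \<in> {0<..<t}")
    case True
    have "(\<lambda>m. of_real (t - \<xi>) powr (\<mu> - 1) * ml_term x y \<alpha> \<beta> \<gamma> (?p m) \<xi>) sums
        (of_real (t - \<xi>) powr (\<mu> - 1) * u \<xi>)"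
      using True u sums_ml_series[of \<xi> x y \<gamma>] by (intro sums_mult) auto
    with True show ?thesis by (simp add: h_def RL_integrand_def sums_iff)
  qed (simp add: h_def)
  show "set_integrable lborel {0<..<t} (RL_integrand \<mu> u t)"
    using integrable_suminf[OF h ae l1] unfolding lim set_integrable_def .
  have "(\<lambda>m. Gamma \<mu> * ml_term x y \<alpha> \<beta> (\<gamma> + \<mu>) (?p m) t) sums
      set_lebesgue_integral lborel {0<..<t} (RL_integrand \<mu> u t)"
    using sums_integral[OF h ae l1] unfolding lim h_int set_lebesgue_integral_def .
  moreover have "(\<lambda>m. Gamma \<mu> * ml_term x y \<alpha> \<beta> (\<gamma> + \<mu>) (?p m) t) sums
      (Gamma \<mu> * ml_series x y \<alpha> \<beta> (\<gamma> + \<mu>) t)"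
    by (intro sums_mult sums_ml_series t)
  ultimately have "set_lebesgue_integral lborel {0<..<t} (RL_integrand \<mu> u t) =
      Gamma \<mu> * ml_series x y \<alpha> \<beta> (\<gamma> + \<mu>) t"
    by (rule sums_unique2)
  moreover have "Gamma \<mu> \<noteq> 0"
    using \<mu> by (auto simp: Gamma_eq_zero_iff elim!: nonpos_Ints_cases)
  ultimately show "RL_integral 0 \<mu> u t = ml_series x y \<alpha> \<beta> (\<gamma> + \<mu>) t"
    by (simp add: RL_integral_def)
qed

lemma iterated_vderiv_ml_series:
  assumes g: "\<And>t. t > 0 \<Longrightarrow> g t = ml_series x y \<alpha> \<beta> \<gamma> t" and "t > 0"
  shows "iterated_vderiv j g t = ml_series x y \<alpha> \<beta> (\<gamma> - of_nat j) t"
    and "iterated_vderiv j g differentiable at t"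
proof -
  have step: "(f has_vector_derivative ml_series x y \<alpha> \<beta> (\<delta> - 1) t) (at t)"
    if f: "\<And>t. t > 0 \<Longrightarrow> f t = ml_series x y \<alpha> \<beta> \<delta> t" and t: "t > 0" for f \<delta> t
  proof (rule has_vector_derivative_transform_within_open)
    show "(ml_series x y \<alpha> \<beta> \<delta> has_vector_derivative ml_series x y \<alpha> \<beta> (\<delta> - 1) t) (at t)"
      using has_vector_derivative_ml_series[OF t, of x y "\<delta> - 1"] by simp
    show "open {0::real<..}" "t \<in> {0<..}" using t by auto
  qed (use f in auto)
  have val: "t > 0 \<Longrightarrow> iterated_vderiv j g t = ml_series x y \<alpha> \<beta> (\<gamma> - of_nat j) t" for j t
  proof (induction j arbitrary: t)
    case 0
    then show ?case by (simp add: iterated_vderiv_def g)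
  next
    case (Suc j)
    have "iterated_vderiv (Suc j) g t = vector_derivative (iterated_vderiv j g) (at t)"
      by (simp add: iterated_vderiv_def)
    also have "\<dots> = ml_series x y \<alpha> \<beta> (\<gamma> - of_nat j - 1) t"
      by (rule vector_derivative_at[OF step[OF Suc.IH Suc.prems]])
    finally show ?case by (simp add: algebra_simps)
  qed
  show "iterated_vderiv j g t = ml_series x y \<alpha> \<beta> (\<gamma> - of_nat j) t"
    using val assms by blast
  show "iterated_vderiv j g differentiable at t"
    using step[OF val \<open>t > 0\<close>] by (rule differentiableI_vector)
qed

text \<open>
  With \<open>m\<close> the number of derivatives, integrating to order \<open>m - \<nu>\<close> and differentiating \<open>m\<close> times
  shifts the parameter by \<open>(m - \<nu>) - m = -\<nu>\<close>.
\<close>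
lemma RL_derivative_ml_series:
  assumes \<nu>: "Re \<nu> > 0" and \<gamma>: "Re \<gamma> > 0"
    and u: "\<And>t. t > 0 \<Longrightarrow> u t = ml_series x y \<alpha> \<beta> \<gamma> t"
  shows "RL_differentiable 0 \<nu> u"
    and "t > 0 \<Longrightarrow> RL_derivative 0 \<nu> u t = ml_series x y \<alpha> \<beta> (\<gamma> - \<nu>) t"
proof -
  define \<mu> where "\<mu> = of_nat (RL_order \<nu>) - \<nu>"
  have "real (RL_order \<nu>) > Re \<nu>"
    using \<nu> by (simp add: RL_order_def) linarith
  then have \<mu>: "Re \<mu> > 0" by (simp add: \<mu>_def)
  have I: "RL_integral 0 \<mu> u t = ml_series x y \<alpha> \<beta> (\<gamma> + \<mu>) t" if "t > 0" for t
    using that u by (intro RL_integral_ml_series \<mu> \<gamma>)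
  show "RL_differentiable 0 \<nu> u"
    unfolding RL_differentiable_def \<mu>_def[symmetric]
    using RL_integral_ml_series(1)[OF \<mu> \<gamma> _ u] iterated_vderiv_ml_series(2)[OF I] by blast
  show "RL_derivative 0 \<nu> u t = ml_series x y \<alpha> \<beta> (\<gamma> - \<nu>) t" if "t > 0"
    using iterated_vderiv_ml_series(1)[OF I that, of "RL_order \<nu>"] that
    by (simp add: RL_derivative_def \<mu>_def)
qed

section \<open>Pascal's rule and the differential equation\<close>

lemma ml_series_three_term:
  assumes t: "t > 0"
  shows "ml_series x y \<alpha> \<beta> \<gamma> t =
    RL_power \<gamma> t + x * ml_series x y \<alpha> \<beta> (\<gamma> + \<alpha>) t + y * ml_series x y \<alpha> \<beta> (\<gamma> + \<beta>) t"
proof -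
  define h where "h = (\<lambda>k l. RL_power (ml_exponent \<alpha> \<beta> \<gamma> (k, l)) t)"
  have "((\<lambda>p. ml_coeff x y p * h (fst p) (snd p)) has_sum
      (h 0 0 + x * ml_series x y \<alpha> \<beta> (\<gamma> + \<alpha>) t + y * ml_series x y \<alpha> \<beta> (\<gamma> + \<beta>) t)) UNIV"
  proof (rule has_sum_ml_coeff_pascal)
    show "((\<lambda>p. ml_coeff x y p * h (Suc (fst p)) (snd p)) has_sum ml_series x y \<alpha> \<beta> (\<gamma> + \<alpha>) t) UNIV"
      using has_sum_ml_series[OF t, of x y "\<gamma> + \<alpha>"]
      by (simp add: ml_term_def h_def ml_exponent_def algebra_simps)
    show "((\<lambda>p. ml_coeff x y p * h (fst p) (Suc (snd p))) has_sum ml_series x y \<alpha> \<beta> (\<gamma> + \<beta>) t) UNIV"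
      using has_sum_ml_series[OF t, of x y "\<gamma> + \<beta>"]
      by (simp add: ml_term_def h_def ml_exponent_def algebra_simps)
  qed
  moreover have "((\<lambda>p. ml_coeff x y p * h (fst p) (snd p)) has_sum ml_series x y \<alpha> \<beta> \<gamma> t) UNIV"
    using has_sum_ml_series[OF t, of x y \<gamma>] by (simp add: ml_term_def h_def)
  ultimately have "h 0 0 + x * ml_series x y \<alpha> \<beta> (\<gamma> + \<alpha>) t + y * ml_series x y \<alpha> \<beta> (\<gamma> + \<beta>) t =
      ml_series x y \<alpha> \<beta> \<gamma> t"
    by (rule has_sum_unique)
  then show ?thesis by (simp add: h_def ml_exponent_def)
qed

text \<open>
  The iterated series in the definition agrees with the unordered sum over pairs because the latter
  converges absolutely. The prefactor is divided out first, so that the summands are literally those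
  of the definition.
\<close>
lemma bivariate_Mittag_Leffler_eq_ml_series:
  assumes t: "t > 0"
  shows "of_real t powr (\<gamma> - 1) *
      bivariate_Mittag_Leffler \<alpha> \<beta> \<gamma> 1 (x * of_real t powr \<alpha>) (y * of_real t powr \<beta>) =
    ml_series x y \<alpha> \<beta> \<gamma> t"
proof -
  let ?c = "complex_of_real t powr (\<gamma> - 1)"
  define f where "f = (\<lambda>(k, l). pochhammer 1 (k + l) * rGamma (\<alpha> * of_nat k + \<beta> * of_nat l + \<gamma>)
      * ((x * of_real t powr \<alpha>) ^ k * (y * of_real t powr \<beta>) ^ l / (fact k * fact l)))"
  have c: "?c \<noteq> 0" using t by simp
  have "?c * f p = ml_term x y \<alpha> \<beta> \<gamma> p t" for p
  proof (cases p)
    case (Pair k l)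
    have "?c * ((of_real t powr \<alpha>) ^ k * (of_real t powr \<beta>) ^ l) =
        of_real t powr (\<alpha> * of_nat k + \<beta> * of_nat l + \<gamma> - 1)"
      using t by (simp add: powr_def algebra_simps flip: exp_of_nat_mult exp_add)
    moreover have "complex_of_nat ((k + l) choose k) = fact (k + l) / (fact k * fact l)"
      by (simp add: binomial_fact)
    ultimately show ?thesis
      by (simp add: Pair f_def ml_term_def ml_coeff_def ml_exponent_def RL_power_def
          power_mult_distrib flip: pochhammer_fact)
  qed
  then have eq: "f = (\<lambda>p. ml_term x y \<alpha> \<beta> \<gamma> p t / ?c)"
    using c by (auto simp: fun_eq_iff field_simps)
  have sum: "(f has_sum (ml_series x y \<alpha> \<beta> \<gamma> t / ?c)) (UNIV \<times> UNIV)"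
    using has_sum_cmult_left[OF has_sum_ml_series[OF t, of x y \<gamma>], of "1 / ?c"] by (simp add: eq)
  have inner: "(\<lambda>l. f (k, l)) summable_on UNIV" for k
    using summable_on_SigmaD1[of "\<lambda>k l. f (k, l)" UNIV "\<lambda>_. UNIV" k] sum
    by (auto simp: summable_on_def)
  have "((\<lambda>k. \<Sum>l. f (k, l)) has_sum (ml_series x y \<alpha> \<beta> \<gamma> t / ?c)) UNIV"
  proof (rule has_sum_SigmaD[OF sum])
    show "((\<lambda>l. f (k, l)) has_sum (\<Sum>l. f (k, l))) UNIV" for k
      using has_sum_imp_sums[OF has_sum_infsum[OF inner]] has_sum_infsum[OF inner]
      by (simp add: sums_iff)
  qed
  then have "(\<Sum>k. \<Sum>l. f (k, l)) = ml_series x y \<alpha> \<beta> \<gamma> t / ?c"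
    by (intro sums_unique[symmetric] has_sum_imp_sums)
  then show ?thesis using c by (simp add: bivariate_Mittag_Leffler_def f_def)
qed

end

theorem theorem2p4:
  fixes \<alpha> \<beta> \<gamma> \<omega>\<^sub>1 \<omega>\<^sub>2 :: complex and u :: "real \<Rightarrow> complex"
  assumes "Re \<alpha> > 0" and "Re \<beta> > 0" and "Re \<gamma> > 0"
    and "\<And>t. t > 0 \<Longrightarrow> u t = of_real t powr (\<gamma> - 1) *
           bivariate_Mittag_Leffler \<alpha> \<beta> \<gamma> 1 (\<omega>\<^sub>1 * of_real t powr \<alpha>) (\<omega>\<^sub>2 * of_real t powr \<beta>)"
  shows "RL_differentiable 0 (\<alpha> + \<beta>) u \<and> RL_differentiable 0 \<alpha> u \<and> RL_differentiable 0 \<beta> u \<and>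
    (\<forall>t>0. RL_derivative 0 (\<alpha> + \<beta>) u t
             - \<omega>\<^sub>2 * RL_derivative 0 \<alpha> u t - \<omega>\<^sub>1 * RL_derivative 0 \<beta> u t
           = of_real t powr (\<gamma> - \<alpha> - \<beta> - 1) * rGamma (\<gamma> - \<alpha> - \<beta>))"
proof -
  have u: "u t = ml_series \<omega>\<^sub>1 \<omega>\<^sub>2 \<alpha> \<beta> \<gamma> t" if "t > 0" for t
    using bivariate_Mittag_Leffler_eq_ml_series[OF assms(1,2) that] assms(4)[OF that] by simp
  note D = RL_derivative_ml_series[OF assms(1,2) _ assms(3) u]
  have "RL_derivative 0 (\<alpha> + \<beta>) u t - \<omega>\<^sub>2 * RL_derivative 0 \<alpha> u t - \<omega>\<^sub>1 * RL_derivative 0 \<beta> u t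
      = of_real t powr (\<gamma> - \<alpha> - \<beta> - 1) * rGamma (\<gamma> - \<alpha> - \<beta>)" if "t > 0" for t
    using ml_series_three_term[OF assms(1,2) that, of \<omega>\<^sub>1 \<omega>\<^sub>2 "\<gamma> - \<alpha> - \<beta>"] assms(1,2) that
    by (simp add: D RL_power_def diff_diff_eq)
  then show ?thesis using D(1) assms(1,2) by auto
qed

end
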